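(* For integers $m,n$ with $n\ge m\ge 1$ and $n\ge 2$, $R_{\pi}(mK_2,nK_2)=2n+m-1$.
   Context: All graphs are finite and simple. For graphs $F,G,H$, write $F\rightarrow(G,H)$ if every red-blue coloring of the edges of $F$ contains a red copy of $G$ or a blue copy of $H$. The Ramsey number $R(G,H)$ is the smallest $r$ with $K_r\rightarrow(G,H)$. $K_r\setminus P_k$ denotes $K_r$ with the edges of a path on $k$ vertices ($k\le r$) deleted. The path-critical Ramsey number is $R_{\pi}(G,H)=\max\{k: K_r\setminus P_k\rightarrow(G,H)\}$ where $r=R(G,H)$. $mK_2$ denotes a matching of $m$ vertex-disjoint edges. *)

theory Defs
  imports "HOL-Library.Ramsey"
begin

type_synonym 'a graph = "'a set \<times> 'a set set"

abbreviation verts :: "'a graph \<Rightarrow> 'a set" where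
  "verts \<equiv> fst"

abbreviation edges :: "'a graph \<Rightarrow> 'a set set" where
  "edges \<equiv> snd"

definition finite_simple_graph :: "'a graph \<Rightarrow> bool" where
  "finite_simple_graph G \<longleftrightarrow> finite (verts G) \<and> edges G \<subseteq> nsets (verts G) 2"

(* A copy is a subgraph isomorphic to G, not necessarily induced. *)
definition contains_copy :: "'a graph \<Rightarrow> 'b graph \<Rightarrow> bool" where
  "contains_copy F G \<longleftrightarrow>
     (\<exists>f. inj_on f (verts G) \<and> f ` verts G \<subseteq> verts F \<and> (\<forall>e \<in> edges G. f ` e \<in> edges F))"

datatype colour = Red | Blue

definition colour_subgraph :: "'a graph \<Rightarrow> ('a set \<Rightarrow> colour) \<Rightarrow> colour \<Rightarrow> 'a graph" where
  "colour_subgraph F c x = (verts F, {e \<in> edges F. c e = x})"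

definition arrows :: "'a graph \<Rightarrow> 'b graph \<Rightarrow> 'c graph \<Rightarrow> bool" where
  "arrows F G H \<longleftrightarrow>
     (\<forall>c. contains_copy (colour_subgraph F c Red) G \<or> contains_copy (colour_subgraph F c Blue) H)"

definition complete_graph :: "nat \<Rightarrow> nat graph" where
  "complete_graph r = ({..<r}, nsets {..<r} 2)"

definition path_graph :: "nat \<Rightarrow> nat graph" where
  "path_graph k = ({..<k}, {{i, Suc i} | i. Suc i < k})"

definition matching_graph :: "nat \<Rightarrow> nat graph" where
  "matching_graph m = ({..<2 * m}, {{2 * i, 2 * i + 1} | i. i < m})"

(* For k \<le> r, all choices of the deleted path in the complete graph are equivalent
   up to isomorphism; here it is the path 0, 1, ..., k - 1. *)
definition complete_minus_path :: "nat \<Rightarrow> nat \<Rightarrow> nat graph" where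
  "complete_minus_path r k =
     (verts (complete_graph r), edges (complete_graph r) - edges (path_graph k))"

definition ramsey_number :: "'a graph \<Rightarrow> 'b graph \<Rightarrow> nat" where
  "ramsey_number G H = (LEAST r. arrows (complete_graph r) G H)"

definition path_critical_ramsey_number :: "'a graph \<Rightarrow> 'b graph \<Rightarrow> nat" where
  "path_critical_ramsey_number G H =
     (let r = ramsey_number G H
      in Max {k. 1 \<le> k \<and> k \<le> r \<and> arrows (complete_minus_path r k) G H})"

lemma finite_simple_complete_graph: "finite_simple_graph (complete_graph r)"
  by (simp add: finite_simple_graph_def complete_graph_def)

lemma finite_simple_path_graph: "finite_simple_graph (path_graph k)"
  by (auto simp: finite_simple_graph_def path_graph_def nsets_def)

lemma finite_simple_matching_graph: "finite_simple_graph (matching_graph m)"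
  by (auto simp: finite_simple_graph_def matching_graph_def nsets_def)

lemma finite_simple_complete_minus_path: "finite_simple_graph (complete_minus_path r k)"
  by (auto simp: finite_simple_graph_def complete_minus_path_def complete_graph_def)

end

theory Submission imports Defs begin

text \<open>
  Write \<open>N = 2n + m - 1\<close>. Colouring the edges inside \<open>2n - 1\<close> vertices blue and all others red
  shows that fewer than \<open>N\<close> vertices do not suffice. Conversely, even \<open>K\<^sub>N\<close> minus a Hamiltonian path
  arrows \<open>(mK\<^sub>2, nK\<^sub>2)\<close>, by induction: if some vertex lies on a red and on a blue edge, delete the
  three vertices of these two edges and pass to \<open>(m - 1, n - 1)\<close>; otherwise the graph, being
  connected, is monochromatic, and pairing the \<open>i\<close>-th vertex of the path with the
  \<open>(i + N div 2)\<close>-th gives a matching of size \<open>N div 2\<close>. The induction stops at \<open>m = 1\<close> and at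
  \<open>m = n = 2\<close>. In the latter case, five of the edges of the complement of the path on
  five vertices form a cyclic sequence in which consecutive edges are disjoint, and two consecutive
  ones must have the same colour.
\<close>

section \<open>Matchings as sets of edges, and complements of paths\<close>

text \<open>A matching is a set of edges here, not an embedding of \<open>matching_graph\<close>, so
  that dropping or adding an edge takes no reindexing.\<close>

definition has_matching :: "'a set set \<Rightarrow> nat \<Rightarrow> bool" where
  "has_matching E k \<longleftrightarrow> (\<exists>M \<subseteq> E. finite M \<and> pairwise disjnt M \<and> card M = k)"

text \<open>
  The complement of the Hamiltonian path visiting \<open>V\<close> in increasing order. Defined like this,
  it is monotone in \<open>V\<close>, so no relabelling is needed when vertices are deleted.
\<close>

definition path_complement :: "nat set \<Rightarrow> nat set set" where
  "path_complement V = {{x, z} | x y z. x \<in> V \<and> y \<in> V \<and> z \<in> V \<and> x < y \<and> y < z}"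

lemma path_complementI:
  "x \<in> V \<Longrightarrow> y \<in> V \<Longrightarrow> z \<in> V \<Longrightarrow> x < y \<Longrightarrow> y < z \<Longrightarrow> {x, z} \<in> path_complement V"
  unfolding path_complement_def by blast

lemma path_complement_mono: "U \<subseteq> V \<Longrightarrow> path_complement U \<subseteq> path_complement V"
  unfolding path_complement_def by blast

lemma path_complement_subset_nsets: "path_complement V \<subseteq> nsets V 2"
  unfolding path_complement_def nsets_def by auto

lemma has_matching_mono: "has_matching E k \<Longrightarrow> E \<subseteq> F \<Longrightarrow> has_matching F k"
  unfolding has_matching_def by blast

lemma has_matching_le:
  assumes "has_matching E l" and "k \<le> l"
  shows "has_matching E k"
proof -
  obtain M where M: "M \<subseteq> E" "finite M" "pairwise disjnt M" "card M = l"
    using assms(1) unfolding has_matching_def by blast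
  obtain M' where "M' \<subseteq> M" "card M' = k" "finite M'"
    using M(4) assms(2) obtain_subset_with_card_n by metis
  then show ?thesis
    using M pairwise_subset[of disjnt M M'] unfolding has_matching_def by blast
qed

text \<open>Used to put an edge back after its ends were deleted. Since \<open>e\<close> is
  nonempty, it is not disjoint from itself and hence is not already in the matching.\<close>

lemma has_matching_Suc:
  assumes "has_matching E k" and "E \<subseteq> F" and "e \<in> F" and "e \<noteq> {}"
    and "\<And>d. d \<in> E \<Longrightarrow> disjnt d e"
  shows "has_matching F (Suc k)"
proof -
  obtain M where M: "M \<subseteq> E" "finite M" "pairwise disjnt M" "card M = k"
    using assms(1) unfolding has_matching_def by blast
  have "e \<notin> M"
    using M(1) assms(4,5) by (metis disjnt_self_iff_empty subsetD)
  then have "card (insert e M) = Suc k"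
    using M by simp
  moreover have "pairwise disjnt (insert e M)"
    using M(1,3) assms(5) by (auto simp: pairwise_insert disjnt_sym)
  ultimately show ?thesis
    using M assms(2,3) unfolding has_matching_def
    by (intro exI[of _ "insert e M"]) auto
qed

lemma has_matching_two:
  assumes "d \<in> E" and "e \<in> E" and "disjnt d e" and "d \<noteq> {}"
  shows "has_matching E 2"
proof -
  have "d \<noteq> e"
    using assms(3,4) by auto
  then show ?thesis
    unfolding has_matching_def
    using assms by (intro exI[of _ "{d, e}"]) (auto simp: pairwise_insert disjnt_sym)
qed

section \<open>Matchings and copies of \<open>matching_graph\<close>\<close>

lemma contains_copy_matching_graph:
  assumes "has_matching E k" and "E \<subseteq> nsets V 2"
  shows "contains_copy (V, E) (matching_graph k)"
proof -
  obtain M where M: "M \<subseteq> E" "finite M" "pairwise disjnt M" "card M = k"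
    using assms(1) unfolding has_matching_def by blast
  obtain h where h: "bij_betw h {..<k} M"
    using ex_bij_betw_nat_finite[OF M(2)] M(4) by (auto simp: atLeast0LessThan)
  have "\<exists>a b. h i = {a, b} \<and> a \<noteq> b \<and> a \<in> V \<and> b \<in> V" if "i < k" for i
  proof -
    have "h i \<in> nsets V 2"
      using that h M(1) assms(2) by (auto simp: bij_betw_def)
    then show ?thesis
      by (auto simp: nsets_def card_2_iff)
  qed
  then obtain a b where ab: "\<And>i. i < k \<Longrightarrow> h i = {a i, b i} \<and> a i \<noteq> b i \<and> a i \<in> V \<and> b i \<in> V"
    by metis
  \<comment> \<open>Vertex \<open>j\<close> of \<open>matching_graph\<close> lies on its edge number
    \<open>j div 2\<close>; its parity selects the end of \<open>h (j div 2)\<close>.\<close>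
  define f where "f j = (if even j then a (j div 2) else b (j div 2))" for j
  have f_mem: "f j \<in> h (j div 2)" if "j < 2 * k" for j
    using ab[of "j div 2"] that unfolding f_def by auto
  have "inj_on f {..<2 * k}"
  proof (rule inj_onI)
    fix i j assume ij: "i \<in> {..<2 * k}" "j \<in> {..<2 * k}" "f i = f j"
    have "i div 2 < k" "j div 2 < k"
      using ij by auto
    \<comment> \<open>A common value is a common point of two matching edges, so these coincide; the
      ends of one edge differ, so the parities agree as well.\<close>
    have "\<not> disjnt (h (i div 2)) (h (j div 2))"
      using f_mem[of i] f_mem[of j] ij by (auto simp: disjnt_iff)
    then have "h (i div 2) = h (j div 2)"
      using M(3) h \<open>i div 2 < k\<close> \<open>j div 2 < k\<close>
      unfolding pairwise_def bij_betw_def by blast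
    then have eq: "i div 2 = j div 2"
      using h \<open>i div 2 < k\<close> \<open>j div 2 < k\<close> unfolding bij_betw_def inj_on_def by simp
    then have "even i = even j"
      using ij(3) ab[OF \<open>j div 2 < k\<close>] unfolding f_def by (auto split: if_splits)
    with eq show "i = j"
      by presburger
  qed
  moreover have "f ` {..<2 * k} \<subseteq> V"
    using ab unfolding f_def by auto
  moreover have "f ` {2 * i, 2 * i + 1} \<in> E" if "i < k" for i
  proof -
    have "f ` {2 * i, 2 * i + 1} = h i"
      using ab[OF that] unfolding f_def by (simp add: insert_commute)
    also have "h i \<in> E"
      using h M(1) that unfolding bij_betw_def by auto
    finally show ?thesis .
  qed
  then have "\<forall>e \<in> {{2 * i, 2 * i + 1} | i. i < k}. f ` e \<in> E"
    by blast
  ultimately show ?thesis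
    unfolding contains_copy_def matching_graph_def fst_conv snd_conv
    by (intro exI[of _ f] conjI)
qed

lemma contains_copy_matching_graphD:
  assumes "contains_copy (V, E) (matching_graph k)"
  obtains f where "inj_on f {..<2 * k}" and "f ` {..<2 * k} \<subseteq> V"
    and "\<And>i. i < k \<Longrightarrow> f ` {2 * i, 2 * i + 1} \<in> E"
proof -
  obtain f where f: "inj_on f {..<2 * k} \<and> f ` {..<2 * k} \<subseteq> V
      \<and> (\<forall>e \<in> {{2 * i, 2 * i + 1} | i. i < k}. f ` e \<in> E)"
    using assms unfolding contains_copy_def matching_graph_def fst_conv snd_conv by (rule exE)
  show ?thesis
  proof (rule that)
    show "f ` {2 * i, 2 * i + 1} \<in> E" if "i < k" for i
      using that by (intro bspec[OF f[THEN conjunct2, THEN conjunct2]]) blast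
  qed (use f in blast)+
qed

section \<open>Edges and matchings in the complement of a path\<close>

text \<open>In the increasing enumeration, having an element of \<open>V\<close> strictly between
  two others means that their indices differ by at least 2.\<close>

lemma path_complement_enumeration:
  assumes "finite V"
  obtains h where "bij_betw h {..<card V} V"
    and "path_complement V = {{h i, h j} | i j. Suc i < j \<and> j < card V}"
proof -
  obtain h where h: "bij_betw h {..<card V} V" "strict_mono_on {..<card V} h"
    using ex_bij_betw_strict_mono_card[OF assms] by metis
  have img: "\<exists>i < card V. v = h i" if "v \<in> V" for v
    using that bij_betw_imp_surj_on[OF h(1)] by blast
  have "{h i, h j} \<in> path_complement V" if "Suc i < j" "j < card V" for i j
    using that h bij_betwE[OF h(1)]
    by (intro path_complementI[where y = "h (Suc i)"]) (auto simp: strict_mono_on_def)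
  moreover have "\<exists>i j. e = {h i, h j} \<and> Suc i < j \<and> j < card V" if "e \<in> path_complement V" for e
  proof -
    obtain x y z where e: "e = {x, z}" "x \<in> V" "y \<in> V" "z \<in> V" "x < y" "y < z"
      using \<open>e \<in> path_complement V\<close> unfolding path_complement_def by blast
    obtain i k j where ijk: "x = h i" "y = h k" "z = h j" "i < card V" "k < card V" "j < card V"
      using img[OF e(2)] img[OF e(3)] img[OF e(4)] by blast
    then have "i < k" "k < j"
      using e(5,6) strict_mono_on_less[OF h(2)] by auto
    with e(1) ijk show ?thesis
      by (intro exI[of _ i] exI[of _ j]) simp
  qed
  ultimately have "path_complement V = {{h i, h j} | i j. Suc i < j \<and> j < card V}"
    by blast
  with h(1) show ?thesis
    using that by blast
qed

lemma has_matching_path_complement: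
  assumes "finite V" and "2 * k \<le> card V" and "2 \<le> k"
  shows "has_matching (path_complement V) k"
proof -
  obtain h where h: "bij_betw h {..<card V} V"
    and edges: "path_complement V = {{h i, h j} | i j. Suc i < j \<and> j < card V}"
    using path_complement_enumeration[OF assms(1)] .
  have edge: "{h i, h j} \<in> path_complement V" if "Suc i < j" "j < card V" for i j
    using that edges by blast
  have h_eq: "h i = h j \<longleftrightarrow> i = j" if "i < 2 * k" "j < 2 * k" for i j
    using h that assms(2) unfolding bij_betw_def by (auto dest: inj_onD)
  \<comment> \<open>The shift \<open>k\<close> is at least 2, so the two ends are not adjacent on
    the path; the edges \<open>p i\<close> with \<open>i < k\<close> use each index below
    \<open>2 * k\<close> once.\<close>
  define p where "p i = {h i, h (i + k)}" for i
  have disj: "disjnt (p i) (p j)" if "i < k" "j < k" "i \<noteq> j" for i j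
    using that unfolding p_def by (simp add: disjnt_def h_eq)
  have inj: "inj_on p {..<k}"
  proof (rule inj_onI)
    fix i j assume "i \<in> {..<k}" "j \<in> {..<k}" "p i = p j"
    then show "i = j"
      using disj[of i j] by (auto simp: p_def disjnt_def)
  qed
  have "p ` {..<k} \<subseteq> path_complement V"
    using assms edge unfolding p_def by auto
  moreover have "pairwise disjnt (p ` {..<k})"
    unfolding pairwise_def using disj by auto
  ultimately show ?thesis
    using inj unfolding has_matching_def
    by (intro exI[of _ "p ` {..<k}"]) (auto simp: card_image)
qed

text \<open>Any edge \<open>{h i, h j}\<close> shares an end with \<open>{h 0, h j}\<close>, which
  shares an end with \<open>{h 0, h 2}\<close>, so all edges have the colour of the last
  one.\<close>

lemma path_complement_monochromatic:
  assumes "finite V" and "4 \<le> card V"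
    and cherry: "\<And>u v w. {u, v} \<in> path_complement V \<Longrightarrow> {v, w} \<in> path_complement V \<Longrightarrow> c {u, v} = c {v, w}"
  shows "\<exists>x. \<forall>e \<in> path_complement V. c e = x"
proof -
  obtain h where h: "bij_betw h {..<card V} V"
    and edges: "path_complement V = {{h i, h j} | i j. Suc i < j \<and> j < card V}"
    using path_complement_enumeration[OF assms(1)] .
  have edge: "{h i, h j} \<in> path_complement V" if "Suc i < j" "j < card V" for i j
    using that edges by blast
  have left: "c {h i, h j} = c {h i, h k}" if "Suc i < j" "j < card V" "Suc i < k" "k < card V" for i j k
    using cherry[of "h j" "h i" "h k"] edge[OF that(1,2)] edge[OF that(3,4)]
    unfolding insert_commute[of "h j" "h i"] by blast
  have right: "c {h i, h k} = c {h j, h k}" if "Suc i < k" "Suc j < k" "k < card V" for i j k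
    using cherry[of "h i" "h k" "h j"] edge[OF that(1,3)] edge[OF that(2,3)]
    unfolding insert_commute[of "h k" "h j"] by blast
  have "c {h i, h j} = c {h 0, h 2}" if "Suc i < j" "j < card V" for i j
  proof -
    have "c {h i, h j} = c {h 0, h j}"
      using that by (intro right) auto
    also have "\<dots> = c {h 0, h 2}"
      using that assms(2) by (intro left) auto
    finally show ?thesis .
  qed
  then have "\<forall>e \<in> path_complement V. c e = c {h 0, h 2}"
    unfolding edges by fast
  then show ?thesis by blast
qed

lemma has_matching_five:
  fixes c :: "nat set \<Rightarrow> colour"
  assumes "finite V" and "card V = 5"
  shows "\<exists>x. has_matching {e \<in> path_complement V. c e = x} 2"
proof -
  obtain h where h: "bij_betw h {..<card V} V"
    and edges: "path_complement V = {{h i, h j} | i j. Suc i < j \<and> j < card V}"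
    using path_complement_enumeration[OF assms(1)] .
  have edge: "{h i, h j} \<in> path_complement V" if "Suc i < j" "j < 5" for i j
    using that edges assms(2) by auto
  have h_eq: "h i = h j \<longleftrightarrow> i = j" if "i < 5" "j < 5" for i j
    using h that assms(2) unfolding bij_betw_def by (auto dest: inj_onD)
  have step: ?thesis if "c {h i, h j} = c {h k, h l}"
    "Suc i < j" "j < 5" "Suc k < l" "l < 5" "i \<noteq> k" "i \<noteq> l" "j \<noteq> k" "j \<noteq> l" for i j k l
    by (intro exI[of _ "c {h i, h j}"] has_matching_two[of "{h i, h j}" _ "{h k, h l}"])
      (use that edge[of i j] edge[of k l] in \<open>auto simp: disjnt_def h_eq\<close>)
  have odd_cycle: "x1 = x2 \<or> x2 = x3 \<or> x3 = x4 \<or> x4 = x5 \<or> x5 = x1" for x1 x2 x3 x4 x5 :: colour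
    by (cases x1; cases x2; cases x3; cases x4; cases x5) simp_all
  \<comment> \<open>The five edges 02, 13, 24, 03, 14 in this cyclic order; only 04 is left
    out.\<close>
  from odd_cycle[of "c {h 0, h 2}" "c {h 1, h 3}" "c {h 2, h 4}" "c {h 0, h 3}" "c {h 1, h 4}"]
  show ?thesis
    by (elim disjE) (erule step; simp)+
qed

section \<open>Two-coloured complements of paths\<close>

lemma path_complement_Ramsey:
  assumes "finite V" and "card V = 2 * n + m - 1" and "1 \<le> m" and "m \<le> n" and "2 \<le> n"
  shows "has_matching {e \<in> path_complement V. c e = Red} m
    \<or> has_matching {e \<in> path_complement V. c e = Blue} n"
  using assms
proof (induction m arbitrary: n V)
  case 0
  then show ?case by simp
next
  case (Suc m n V)
  let ?E = "\<lambda>V x. {e \<in> path_complement V. c e = x}"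
  \<comment> \<open>In either colour a matching of size \<open>n\<close> suffices because
    \<open>Suc m \<le> n\<close>.\<close>
  have mono: ?case if "\<forall>e \<in> path_complement V. c e = x" for x
  proof -
    have eq: "?E V x = path_complement V"
      using that by auto
    have "has_matching (?E V x) n"
      unfolding eq using Suc.prems by (intro has_matching_path_complement) auto
    then show ?thesis
      using Suc.prems has_matching_le by (cases x) blast+
  qed
  \<comment> \<open>The value being treated is \<open>Suc m\<close>. The second case is separate
    because the induction step would lead to \<open>n = 1\<close>, where the claim fails: two
    vertices give no edge.\<close>
  consider "m = 0" | "m = 1" "n = 2" | "1 \<le> m" "3 \<le> n"
    using Suc.prems by linarith
  then show ?case
  proof cases
    case 1
    show ?thesis
    proof (cases "?E V Red = {}")
      case True
      then have "\<forall>e \<in> path_complement V. c e = Blue"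
        using colour.exhaust by blast
      then show ?thesis by (rule mono)
    next
      case False
      then obtain e where "e \<in> ?E V Red" by blast
      then have "has_matching (?E V Red) (Suc m)"
        unfolding has_matching_def 1 by (intro exI[of _ "{e}"]) auto
      then show ?thesis ..
    qed
  next
    case 2
    then have "\<exists>x. has_matching (?E V x) 2"
      using Suc.prems by (intro has_matching_five) auto
    then obtain x where "has_matching (?E V x) 2" by blast
    then show ?thesis
      using 2 by (cases x) (auto simp: numeral_2_eq_2)
  next
    case 3
    show ?thesis
    proof (cases "\<exists>u v w. {u, v} \<in> path_complement V \<and> {v, w} \<in> path_complement V \<and> c {u, v} \<noteq> c {v, w}")
      case False
      have "\<exists>x. \<forall>e \<in> path_complement V. c e = x"
        using 3 Suc.prems False by (intro path_complement_monochromatic) auto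
      then show ?thesis using mono by blast
    next
      case True
      then obtain u v w where uvw: "{u, v} \<in> path_complement V" "{v, w} \<in> path_complement V"
        "c {u, v} \<noteq> c {v, w}" by blast
      define U where "U = V - {u, v, w}"
      have "{u, v} \<in> nsets V 2" "{v, w} \<in> nsets V 2"
        using uvw path_complement_subset_nsets by blast+
      then have "{u, v, w} \<subseteq> V" "u \<noteq> v" "v \<noteq> w"
        by (auto simp: nsets_def card_2_iff)
      \<comment> \<open>Otherwise both pairs would be the same edge with two colours.\<close>
      moreover have "u \<noteq> w"
        using uvw(3) by (auto simp: insert_commute)
      ultimately have "{u, v, w} \<subseteq> V" "card {u, v, w} = 3"
        by auto
      then have "card U = 2 * (n - 1) + m - 1"
        using Suc.prems 3 unfolding U_def by (subst card_Diff_subset) auto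
      then have IH: "has_matching (?E U Red) m \<or> has_matching (?E U Blue) (n - 1)"
        using Suc.prems 3 by (intro Suc.IH) (auto simp: U_def)
      \<comment> \<open>The two edges at \<open>v\<close> carry both colours, so whichever colour
        has the matching in \<open>U\<close>, one of them extends it.\<close>
      have extend: "has_matching (?E V x) (Suc k)" if "has_matching (?E U x) k" for x k
      proof -
        have "c {u, v} = x \<or> c {v, w} = x"
          using uvw(3) by (cases "c {u, v}"; cases "c {v, w}"; cases x) simp_all
        then obtain e where e: "e \<in> {{u, v}, {v, w}}" "c e = x"
          by blast
        show ?thesis
        proof (rule has_matching_Suc[OF that])
          show "?E U x \<subseteq> ?E V x"
            using path_complement_mono[of U V] unfolding U_def by auto
          show "disjnt d e" if "d \<in> ?E U x" for d
          proof -
            have "d \<subseteq> U"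
              using that path_complement_subset_nsets[of U] by (auto simp: nsets_def)
            then show ?thesis
              using e(1) unfolding U_def disjnt_def by auto
          qed
        qed (use e uvw in auto)
      qed
      have "Suc (n - 1) = n" using 3 by simp
      then show ?thesis
        using IH extend[of Red m] extend[of Blue "n - 1"] by auto
    qed
  qed
qed

section \<open>The Ramsey number and the path-critical number\<close>

text \<open>Allowing any \<open>E\<close> above the path complement covers both
  \<open>complete_graph\<close> and \<open>complete_minus_path\<close>.\<close>

lemma arrows_matching_if_path_complement:
  assumes "path_complement V \<subseteq> E" and "E \<subseteq> nsets V 2"
    and "finite V" and "card V = 2 * n + m - 1" and "1 \<le> m" and "m \<le> n" and "2 \<le> n"
  shows "arrows (V, E) (matching_graph m) (matching_graph n)"
  unfolding arrows_def
proof
  fix c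
  have copy: "contains_copy (colour_subgraph (V, E) c x) (matching_graph k)"
    if "has_matching {e \<in> path_complement V. c e = x} k" for x k
    unfolding colour_subgraph_def fst_conv snd_conv
    using assms(1,2) by (intro contains_copy_matching_graph has_matching_mono[OF that]) auto
  show "contains_copy (colour_subgraph (V, E) c Red) (matching_graph m)
    \<or> contains_copy (colour_subgraph (V, E) c Blue) (matching_graph n)"
    using path_complement_Ramsey[OF assms(3-7), of c] copy[of Red m] copy[of Blue n] by argo
qed

text \<open>A blue matching has too few vertices available, while each red edge needs its own end
  among the fewer than \<open>m\<close> vertices from \<open>2 * n - 1\<close> on.\<close>

lemma not_arrows_complete_graph:
  assumes "r < 2 * n + m - 1" and "1 \<le> m" and "1 \<le> n"
  shows "\<not> arrows (complete_graph r) (matching_graph m) (matching_graph n)"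
proof
  assume arr: "arrows (complete_graph r) (matching_graph m) (matching_graph n)"
  define c where "c e = (if e \<subseteq> {..<2 * n - 1} then Blue else Red)" for e :: "nat set"
  from arr consider
      "contains_copy (colour_subgraph (complete_graph r) c Red) (matching_graph m)"
    | "contains_copy (colour_subgraph (complete_graph r) c Blue) (matching_graph n)"
    unfolding arrows_def by blast
  then show False
  proof cases
    case 1
    then obtain f where f: "inj_on f {..<2 * m}" "f ` {..<2 * m} \<subseteq> {..<r}"
      and red: "\<And>i. i < m \<Longrightarrow> c (f ` {2 * i, 2 * i + 1}) = Red"
      unfolding colour_subgraph_def complete_graph_def fst_conv snd_conv
      by (elim contains_copy_matching_graphD) blast
    have "\<exists>j. j div 2 = i \<and> 2 * n - 1 \<le> f j" if "i < m" for i
    proof -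
      obtain j where "j \<in> {2 * i, 2 * i + 1}" "\<not> f j < 2 * n - 1"
        using red[OF \<open>i < m\<close>] unfolding c_def by (auto split: if_splits)
      then show ?thesis by (intro exI[of _ j]) auto
    qed
    \<comment> \<open>\<open>t i\<close> is an end of edge \<open>i\<close> of
      \<open>matching_graph\<close> that is mapped outside the blue clique; \<open>t\<close> is
      injective since \<open>t i div 2 = i\<close>.\<close>
    then obtain t where t: "\<And>i. i < m \<Longrightarrow> t i div 2 = i \<and> 2 * n - 1 \<le> f (t i)"
      by metis
    have t_less: "t i < 2 * m" if "i < m" for i
      using t[OF that] that by linarith
    have "inj_on (f \<circ> t) {..<m}"
    proof (rule comp_inj_on)
      show "inj_on t {..<m}"
        using t by (metis inj_onI lessThan_iff)
      show "inj_on f (t ` {..<m})"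
        using t_less by (intro inj_on_subset[OF f(1)]) auto
    qed
    moreover have "(f \<circ> t) ` {..<m} \<subseteq> {2 * n - 1..<r}"
      using t t_less f(2) by (auto simp: image_subset_iff)
    ultimately have "card {..<m} \<le> card {2 * n - 1..<r}"
      by (rule card_inj_on_le) simp
    then show False
      using assms by simp
  next
    case 2
    then obtain f where f: "inj_on f {..<2 * n}"
      and blue: "\<And>i. i < n \<Longrightarrow> c (f ` {2 * i, 2 * i + 1}) = Blue"
      unfolding colour_subgraph_def complete_graph_def fst_conv snd_conv
      by (elim contains_copy_matching_graphD) blast
    have "f j < 2 * n - 1" if "j < 2 * n" for j
    proof -
      have "j div 2 < n"
        using that by simp
      then have "f ` {2 * (j div 2), 2 * (j div 2) + 1} \<subseteq> {..<2 * n - 1}"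
        using blue unfolding c_def by (meson colour.distinct(1))
      moreover have "j \<in> {2 * (j div 2), 2 * (j div 2) + 1}"
        by auto
      ultimately show ?thesis by blast
    qed
    then have "f ` {..<2 * n} \<subseteq> {..<2 * n - 1}"
      by auto
    then have "card {..<2 * n} \<le> card {..<2 * n - 1}"
      using f by (intro card_inj_on_le) auto
    then show False
      using assms by simp
  qed
qed

theorem theorem5:
  fixes m n :: nat
  assumes "n \<ge> m" and "m \<ge> 1" and "n \<ge> 2"
  shows "path_critical_ramsey_number (matching_graph m) (matching_graph n) = 2 * n + m - 1"
proof -
  define r where "r = 2 * n + m - 1"
  have "arrows (complete_graph r) (matching_graph m) (matching_graph n)"
    unfolding complete_graph_def
    using assms path_complement_subset_nsets
    by (intro arrows_matching_if_path_complement) (auto simp: r_def)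
  moreover have "r \<le> s" if "arrows (complete_graph s) (matching_graph m) (matching_graph n)" for s
    using that not_arrows_complete_graph[of s n m] assms unfolding r_def by linarith
  ultimately have ramsey: "ramsey_number (matching_graph m) (matching_graph n) = r"
    unfolding ramsey_number_def by (rule Least_equality)
  \<comment> \<open>The deleted path joins consecutive numbers, which have nothing strictly between
    them.\<close>
  have "path_complement {..<r} \<inter> edges (path_graph r) = {}"
    unfolding path_complement_def path_graph_def by (auto simp: doubleton_eq_iff)
  then have "arrows (complete_minus_path r r) (matching_graph m) (matching_graph n)"
    unfolding complete_minus_path_def complete_graph_def fst_conv snd_conv
    using assms path_complement_subset_nsets[of "{..<r}"]
    by (intro arrows_matching_if_path_complement) (auto simp: r_def)
  \<comment> \<open>The largest admissible length \<open>k = r\<close> already belongs to the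
    set.\<close>
  then have "Max {k. 1 \<le> k \<and> k \<le> r \<and>
      arrows (complete_minus_path r k) (matching_graph m) (matching_graph n)} = r"
    using assms by (intro Max_eqI) (auto simp: r_def)
  then show ?thesis
    unfolding path_critical_ramsey_number_def ramsey Let_def r_def .
qed

end
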